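(* Let $G$ be a non-trivial totally disconnected, locally compact group. Suppose that $G$ has a non-degenerate faithful weakly decomposable action on a Boolean algebra, and suppose there exists $g \in G$ such that $\mathrm{con}(g) \neq \{1\}$. Then there exists $h \in G$ such that $\mathrm{con}(h)$ is not closed.
   Context: Topological groups are Hausdorff. An action of $G$ by automorphisms on a Boolean algebra $\mathcal{A}$ is non-degenerate faithful weakly decomposable if it is faithful and for every $\alpha \in \mathcal{A}\setminus\{0\}$, the stabilizer of $\alpha$ in $G$ is open and the pointwise stabilizer in $G$ of $\{\beta\in\mathcal{A} \mid \alpha\wedge\beta=0\}$ is non-discrete. For $g\in G$, $\mathrm{con}(g) = \{x \in G \mid g^n x g^{-n} \to 1 \text{ as } n \to +\infty\}$. *)

theory Defs
  imports "HOL-Analysis.Analysis" "HOL-Algebra.Group_Action"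
begin

text \<open>Topological groups are Hausdorff by convention.\<close>

locale topological_group = group G for G (structure) +
  fixes T :: "'a topology"
  assumes topspace_eq_carrier: "topspace T = carrier G"
    and continuous_mult: "continuous_map (prod_topology T T) T (\<lambda>(x, y). x \<otimes> y)"
    and continuous_inv: "continuous_map T T (\<lambda>x. inv x)"
    and Hausdorff: "Hausdorff_space T"

definition totally_disconnected_space :: "'a topology \<Rightarrow> bool" where
  "totally_disconnected_space T \<longleftrightarrow> (\<forall>C. connectedin T C \<longrightarrow> (\<exists>x. C \<subseteq> {x}))"

locale tdlc_group = topological_group +
  assumes totally_disconnected: "totally_disconnected_space T"
    and locally_compact: "locally_compact_space T"

definition con :: "('a, 'm) monoid_scheme \<Rightarrow> 'a topology \<Rightarrow> 'a \<Rightarrow> 'a set" where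
  "con G T g = {x \<in> carrier G.
     limitin T (\<lambda>n::nat. g [^]\<^bsub>G\<^esub> n \<otimes>\<^bsub>G\<^esub> x \<otimes>\<^bsub>G\<^esub> inv\<^bsub>G\<^esub> (g [^]\<^bsub>G\<^esub> n)) \<one>\<^bsub>G\<^esub> sequentially}"

text \<open>The Boolean algebra is the whole type \<open>'b\<close>.  Bijectivity of each \<open>\<phi> g\<close> is part of
  \<^locale>\<open>group_action\<close>, and preservation of \<open>bot\<close> and \<open>top\<close> follows from the equations below.\<close>

locale boolean_algebra_action = group_action G "UNIV :: 'b::boolean_algebra set" \<phi>
  for G (structure) and \<phi> :: "'a \<Rightarrow> 'b::boolean_algebra \<Rightarrow> 'b" +
  assumes map_inf: "g \<in> carrier G \<Longrightarrow> \<phi> g (inf \<alpha> \<beta>) = inf (\<phi> g \<alpha>) (\<phi> g \<beta>)"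
    and map_sup: "g \<in> carrier G \<Longrightarrow> \<phi> g (sup \<alpha> \<beta>) = sup (\<phi> g \<alpha>) (\<phi> g \<beta>)"
    and map_compl: "g \<in> carrier G \<Longrightarrow> \<phi> g (- \<alpha>) = - \<phi> g \<alpha>"

definition pointwise_stabilizer ::
    "('a, 'm) monoid_scheme \<Rightarrow> ('a \<Rightarrow> 'b \<Rightarrow> 'b) \<Rightarrow> 'b set \<Rightarrow> 'a set" where
  "pointwise_stabilizer G \<phi> B = {g \<in> carrier G. \<forall>\<beta>\<in>B. \<phi> g \<beta> = \<beta>}"

locale faithful_weakly_decomposable_action =
    boolean_algebra_action G \<phi> + faithful_action G "UNIV :: 'b set" \<phi>
  for G (structure) and T :: "'a topology" and \<phi> :: "'a \<Rightarrow> 'b::boolean_algebra \<Rightarrow> 'b" +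
  assumes open_stabilizer: "\<alpha> \<noteq> bot \<Longrightarrow> openin T (stabilizer G \<phi> \<alpha>)"
    and non_discrete: "\<alpha> \<noteq> bot \<Longrightarrow>
      \<not> (let S = pointwise_stabilizer G \<phi> {\<beta>. inf \<alpha> \<beta> = bot}
         in subtopology T S = discrete_topology S)"

end

theory Submission
  imports Defs
begin

text \<open>Let \<open>U\<close> be a compact open subgroup. Two facts drive the proof.

  First, if \<open>h\<close> has a wandering element \<open>\<delta> \<noteq> bot\<close> (the translates \<open>h\<^sup>n\<delta>\<close>, \<open>n \<in> \<int>\<close>, are
  pairwise disjoint), then \<open>con(h)\<close> is not closed. As \<open>U\<close>-orbits in the Boolean algebra are
  finite, elements of \<open>U\<close> supported on \<open>h\<^sup>n\<delta>\<close> tend to \<open>1\<close> as \<open>\<bar>n\<bar> \<rightarrow> \<infinity>\<close>. This produces a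
  nontrivial element of \<open>con(h)\<close> with relatively compact orbit under conjugation by \<open>h\<close>, which
  cannot exist when \<open>con(h)\<close> is closed.

  Second, let \<open>V\<close> be a small open subgroup of \<open>U\<close>. If below some \<open>\<beta>\<^sub>0 \<noteq> bot\<close> every rigid
  stabilizer contains an element of \<open>V\<close> whose forward orbit under conjugation by \<open>g\<close> (or by
  \<open>g\<^sup>-\<^sup>1\<close>) leaves \<open>V\<close>, then a pigeonhole argument finds \<open>\<sigma>\<close> and a power \<open>h\<close> of \<open>g\<close> with
  \<open>h\<sigma> < \<sigma>\<close>, and \<open>\<sigma> - h\<sigma>\<close> is wandering. Otherwise, for \<open>1 \<noteq> x \<in> con(g)\<close> and \<open>\<alpha> \<noteq> bot\<close>
  disjoint from \<open>x\<alpha>\<close>, there is \<open>bot \<noteq> \<beta> \<le> \<alpha>\<close> such that the elements of \<open>V\<close> supported on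
  \<open>\<beta>\<close> have bounded orbits. For such \<open>z\<close> and \<open>w\<close> the commutator \<open>[z, w] = [[z, x], w]\<close> lies in
  \<open>con(g)\<close> and has a bounded orbit; it can be chosen nontrivial.\<close>

section \<open>Rigid stabilizers\<close>

lemma (in group) conj_mult:
  assumes "g \<in> carrier G" "x \<in> carrier G" "y \<in> carrier G"
  shows "g \<otimes> (x \<otimes> y) \<otimes> inv g = (g \<otimes> x \<otimes> inv g) \<otimes> (g \<otimes> y \<otimes> inv g)"
proof -
  have "inv g \<otimes> (g \<otimes> (y \<otimes> inv g)) = y \<otimes> inv g"
    using assms by (simp flip: m_assoc)
  then show ?thesis
    using assms by (simp add: m_assoc)
qed

lemma (in group) conj_inv:
  assumes "g \<in> carrier G" "x \<in> carrier G"
  shows "g \<otimes> inv x \<otimes> inv g = inv (g \<otimes> x \<otimes> inv g)"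
  using assms by (simp add: m_assoc inv_mult_group)

lemma (in group) conj_conj:
  assumes "g \<in> carrier G" "h \<in> carrier G" "x \<in> carrier G"
  shows "g \<otimes> (h \<otimes> x \<otimes> inv h) \<otimes> inv g = (g \<otimes> h) \<otimes> x \<otimes> inv (g \<otimes> h)"
  using assms by (simp add: m_assoc inv_mult_group)

locale tdlc_weakly_decomposable =
  tdlc_group G T + faithful_weakly_decomposable_action G T \<phi>
  for G (structure) and T :: "'a topology" and \<phi> :: "'a \<Rightarrow> 'b::boolean_algebra \<Rightarrow> 'b"
begin

text \<open>The rigid stabilizer: fixing everything disjoint from \<open>\<alpha>\<close> expresses
  being supported on \<open>\<alpha>\<close> without reference to points.\<close>

abbreviation rist :: "'b \<Rightarrow> 'a set" where
  "rist \<alpha> \<equiv> pointwise_stabilizer G \<phi> {\<beta>. inf \<alpha> \<beta> = bot}"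

lemma act_one [simp]: "\<phi> \<one> a = a"
  by (metis UNIV_I id_eq_one restrict_apply')

lemma act_mult: "g \<in> carrier G \<Longrightarrow> h \<in> carrier G \<Longrightarrow> \<phi> (g \<otimes> h) a = \<phi> g (\<phi> h a)"
  by (simp add: composition_rule)

lemma act_inv_act [simp]: "g \<in> carrier G \<Longrightarrow> \<phi> (inv g) (\<phi> g a) = a"
  by (metis act_mult act_one inv_closed l_inv)

lemma act_act_inv [simp]: "g \<in> carrier G \<Longrightarrow> \<phi> g (\<phi> (inv g) a) = a"
  by (metis act_mult act_one inv_closed r_inv)

lemma act_inv_fix: "g \<in> carrier G \<Longrightarrow> \<phi> g a = a \<Longrightarrow> \<phi> (inv g) a = a"
  by (metis act_inv_act)

lemma act_eq_iff [simp]: "g \<in> carrier G \<Longrightarrow> \<phi> g a = \<phi> g b \<longleftrightarrow> a = b"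
  by (metis act_inv_act)

lemma act_bot [simp]: "g \<in> carrier G \<Longrightarrow> \<phi> g bot = bot"
  by (metis inf_compl_bot map_compl map_inf)

lemma act_eq_bot_iff [simp]: "g \<in> carrier G \<Longrightarrow> \<phi> g a = bot \<longleftrightarrow> a = bot"
  by (metis act_bot act_eq_iff)

lemma act_le_iff [simp]: "g \<in> carrier G \<Longrightarrow> \<phi> g a \<le> \<phi> g b \<longleftrightarrow> a \<le> b"
  by (metis act_eq_iff le_iff_inf map_inf)

lemma act_less_iff [simp]: "g \<in> carrier G \<Longrightarrow> \<phi> g a < \<phi> g b \<longleftrightarrow> a < b"
  by (simp add: less_le)

lemma act_diff: "g \<in> carrier G \<Longrightarrow> \<phi> g (a - b) = \<phi> g a - \<phi> g b"
  by (simp add: diff_eq map_inf map_compl)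

lemma act_conj_eq_iff:
  assumes "g \<in> carrier G" "x \<in> carrier G"
  shows "\<phi> (g \<otimes> x \<otimes> inv g) a = a \<longleftrightarrow> \<phi> x (\<phi> (inv g) a) = \<phi> (inv g) a"
  by (metis act_act_inv act_eq_iff act_mult assms inv_closed m_closed)

lemma faithfulE:
  assumes "x \<in> carrier G" "x \<noteq> \<one>"
  obtains \<xi> where "\<phi> x \<xi> \<noteq> \<xi>"
  by (metis act_one assms ext faithful inj_onD one_closed)

lemma rist_carrier: "z \<in> rist \<alpha> \<Longrightarrow> z \<in> carrier G"
  by (simp add: pointwise_stabilizer_def)

lemma rist_fix_disjoint: "z \<in> rist \<alpha> \<Longrightarrow> inf \<alpha> \<beta> = bot \<Longrightarrow> \<phi> z \<beta> = \<beta>"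
  by (simp add: pointwise_stabilizer_def)

lemma rist_fix: "z \<in> rist \<alpha> \<Longrightarrow> \<phi> z \<alpha> = \<alpha>"
  by (metis boolean_algebra_class.boolean_algebra.double_compl inf_compl_bot map_compl rist_carrier rist_fix_disjoint)

lemma rist_mono: "\<alpha> \<le> \<beta> \<Longrightarrow> rist \<alpha> \<subseteq> rist \<beta>"
  unfolding pointwise_stabilizer_def
  by (smt (verit, ccfv_threshold) bot.extremum_uniqueI inf_mono mem_Collect_eq order_refl subsetI)

lemma rist_conj:
  assumes "g \<in> carrier G" "z \<in> rist \<alpha>"
  shows "g \<otimes> z \<otimes> inv g \<in> rist (\<phi> g \<alpha>)"
proof -
  have "\<phi> (g \<otimes> z \<otimes> inv g) \<beta> = \<beta>" if "inf (\<phi> g \<alpha>) \<beta> = bot" for \<beta>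
  proof -
    have "inf \<alpha> (\<phi> (inv g) \<beta>) = bot"
      by (metis act_act_inv act_eq_bot_iff assms(1) map_inf that)
    then show ?thesis
      using assms rist_carrier rist_fix_disjoint act_conj_eq_iff by metis
  qed
  then show ?thesis
    using assms by (simp add: pointwise_stabilizer_def)
qed

lemma rist_decompose:
  assumes "z \<in> rist \<alpha>"
  shows "\<phi> z \<xi> = sup (\<phi> z (inf \<xi> \<alpha>)) (inf \<xi> (- \<alpha>))" "\<phi> z (inf \<xi> \<alpha>) \<le> \<alpha>"
proof -
  have "\<phi> z (inf \<xi> (- \<alpha>)) = inf \<xi> (- \<alpha>)"
    by (rule rist_fix_disjoint [OF assms]) (simp add: inf_left_commute)
  moreover have "\<xi> = sup (inf \<xi> \<alpha>) (inf \<xi> (- \<alpha>))"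
    by (simp flip: inf_sup_distrib1)
  ultimately show "\<phi> z \<xi> = sup (\<phi> z (inf \<xi> \<alpha>)) (inf \<xi> (- \<alpha>))"
    by (metis assms map_sup rist_carrier)
  show "\<phi> z (inf \<xi> \<alpha>) \<le> \<alpha>"
    by (metis act_le_iff assms inf.cobounded2 rist_carrier rist_fix)
qed

text \<open>The part of \<open>\<xi>\<close> outside \<open>\<alpha>\<close> is fixed. Used to bound
  supports from below by displacements and to separate elements with disjoint supports.\<close>

lemma rist_displacement:
  assumes "z \<in> rist \<alpha>"
  shows "\<phi> z \<xi> - \<xi> \<le> \<alpha>" "\<xi> - \<phi> z \<xi> \<le> \<alpha>"
proof -
  have "\<phi> z \<xi> \<le> sup \<alpha> \<xi>"
    by (metis rist_decompose [OF assms] inf.cobounded1 sup_mono)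
  then show "\<phi> z \<xi> - \<xi> \<le> \<alpha>"
    by (metis diff_eq shunt1 double_compl sup_commute)
  have "\<xi> \<le> sup \<alpha> (inf \<xi> (- \<alpha>))"
    by (simp add: sup_inf_distrib1)
  then have "\<xi> \<le> sup \<alpha> (\<phi> z \<xi>)"
    by (metis rist_decompose(1) [OF assms] order_trans sup.cobounded2 sup.mono order_refl)
  then show "\<xi> - \<phi> z \<xi> \<le> \<alpha>"
    by (metis diff_eq shunt1 double_compl sup_commute)
qed

text \<open>Each \<open>\<xi>\<close> splits into a part below \<open>\<alpha>\<close>, fixed
  because \<open>z\<close> is in \<open>rist \<beta>\<close>, and a part outside, fixed because
  \<open>z\<close> is in \<open>rist \<alpha>\<close>. Faithfulness does the rest.\<close>

lemma rist_disjoint_Int: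
  assumes "z \<in> rist \<alpha>" "z \<in> rist \<beta>" "inf \<alpha> \<beta> = bot"
  shows "z = \<one>"
proof (rule ccontr)
  assume "z \<noteq> \<one>"
  then obtain \<xi> where "\<phi> z \<xi> \<noteq> \<xi>"
    using assms(1) faithfulE rist_carrier by metis
  moreover have "\<phi> z (inf \<xi> \<alpha>) = inf \<xi> \<alpha>"
    by (rule rist_fix_disjoint [OF assms(2)]) (metis assms(3) inf_bot_right inf_commute inf_left_commute)
  ultimately show False
    by (metis rist_decompose(1) [OF assms(1)] inf_sup_distrib1 sup_compl_top inf_top_right)
qed

text \<open>Each element fixes the support of the other, so their commutator lies in both rigid
  stabilizers and is trivial.\<close>

lemma rist_disjoint_commute:
  assumes "x \<in> rist \<alpha>" "y \<in> rist \<beta>" "inf \<alpha> \<beta> = bot"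
  shows "x \<otimes> y = y \<otimes> x"
proof -
  have G: "x \<in> carrier G" "y \<in> carrier G"
    using assms rist_carrier by auto
  have inv: "inv z \<in> rist \<gamma>" if "z \<in> rist \<gamma>" for z \<gamma>
    using that unfolding pointwise_stabilizer_def by (auto, metis act_inv_act)
  have mult: "z \<otimes> w \<in> rist \<gamma>" if "z \<in> rist \<gamma>" "w \<in> rist \<gamma>" for z w \<gamma>
    using that unfolding pointwise_stabilizer_def by (auto simp: act_mult)
  have "x \<otimes> y \<otimes> inv x \<in> rist \<beta>"
    using rist_conj [OF G(1) assms(2)] rist_fix_disjoint [OF assms(1,3)] by simp
  then have "x \<otimes> y \<otimes> inv x \<otimes> inv y \<in> rist \<beta>"
    by (simp add: assms inv mult)
  moreover have "y \<otimes> inv x \<otimes> inv y \<in> rist \<alpha>"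
    using rist_conj [OF G(2) inv [OF assms(1)]] rist_fix_disjoint [OF assms(2), of \<alpha>] assms(3)
    by (simp add: inf_commute)
  then have "x \<otimes> (y \<otimes> inv x \<otimes> inv y) \<in> rist \<alpha>"
    by (simp add: assms mult)
  ultimately have "x \<otimes> y \<otimes> inv x \<otimes> inv y = \<one>"
    using rist_disjoint_Int [OF _ _ assms(3)] G by (simp add: m_assoc)
  then have "x \<otimes> y \<otimes> inv (y \<otimes> x) = \<one>"
    using G by (simp add: m_assoc inv_mult_group)
  then show ?thesis
    using G by (metis inv_closed inv_equality inv_inv m_closed)
qed

text \<open>If \<open>x\<close> moves \<open>\<xi>\<close>, one of the differences between
  \<open>\<xi>\<close> and its image is nonzero, and each is disjoint from its own image. The last
  conclusion keeps the displaced element inside a prescribed support.\<close>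

lemma exists_displaced:
  assumes "x \<in> carrier G" "x \<noteq> \<one>"
  obtains \<alpha> where "\<alpha> \<noteq> bot" "inf \<alpha> (\<phi> x \<alpha>) = bot" "\<And>\<beta>. x \<in> rist \<beta> \<Longrightarrow> \<alpha> \<le> \<beta>"
proof -
  obtain \<xi> where \<xi>: "\<phi> x \<xi> \<noteq> \<xi>"
    using assms faithfulE by metis
  show ?thesis
  proof (cases "\<xi> - \<phi> x \<xi> = bot")
    case False
    have "inf (\<xi> - \<phi> x \<xi>) (\<phi> x (\<xi> - \<phi> x \<xi>)) \<le> inf (- \<phi> x \<xi>) (\<phi> x \<xi>)"
      using assms by (simp add: diff_eq map_inf le_infI1 le_infI2)
    then have "inf (\<xi> - \<phi> x \<xi>) (\<phi> x (\<xi> - \<phi> x \<xi>)) = bot"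
      by (simp add: bot_unique)
    with False show ?thesis
      using that rist_displacement(2) by blast
  next
    case True
    then have "\<xi> \<le> \<phi> x \<xi>"
      by (simp add: diff_shunt_var)
    with \<xi> have ne: "\<phi> x \<xi> - \<xi> \<noteq> bot"
      by (auto simp: diff_shunt_var)
    have "inf (\<phi> x \<xi> - \<xi>) (\<phi> x (\<phi> x \<xi> - \<xi>)) \<le> inf (\<phi> x \<xi>) (- \<phi> x \<xi>)"
      using assms by (simp add: diff_eq map_inf map_compl le_infI1 le_infI2)
    then have "inf (\<phi> x \<xi> - \<xi>) (\<phi> x (\<phi> x \<xi> - \<xi>)) = bot"
      by (simp add: bot_unique)
    with ne show ?thesis
      using that rist_displacement(1) by blast
  qed
qed

end

section \<open>Topology from stabilizers\<close>

lemma compactin_finite_subcover_UN: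
  assumes "compactin X K" "\<And>i. i \<in> I \<Longrightarrow> openin X (V i)" "K \<subseteq> (\<Union>i\<in>I. V i)"
  obtains J where "finite J" "J \<subseteq> I" "K \<subseteq> (\<Union>i\<in>J. V i)"
proof -
  have "\<forall>U\<in>V ` I. openin X U"
    using assms(2) by blast
  then obtain \<F> where "finite \<F>" "\<F> \<subseteq> V ` I" "K \<subseteq> \<Union>\<F>"
    using assms(1,3) unfolding compactin_def by meson
  then show ?thesis
    using that finite_subset_image by metis
qed

section \<open>Continuity of translations; open and compact open subgroups\<close>

context topological_group
begin

lemma continuous_mult_maps:
  assumes "continuous_map X T f" "continuous_map X T h"
  shows "continuous_map X T (\<lambda>x. f x \<otimes> h x)"
  using continuous_map_compose [OF continuous_map_pairedI [OF assms] continuous_mult]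
  by (simp add: o_def)

lemma continuous_left_mult: "a \<in> carrier G \<Longrightarrow> continuous_map T T (\<lambda>x. a \<otimes> x)"
  by (intro continuous_mult_maps) (auto simp: topspace_eq_carrier)

lemma continuous_conj: "a \<in> carrier G \<Longrightarrow> continuous_map T T (\<lambda>x. a \<otimes> x \<otimes> inv a)"
  by (intro continuous_mult_maps continuous_left_mult) (auto simp: topspace_eq_carrier)

lemma openin_left_preimage:
  assumes "a \<in> carrier G" "openin T S"
  shows "openin T {x \<in> carrier G. a \<otimes> x \<in> S}"
  using openin_continuous_map_preimage [OF continuous_left_mult assms(2)] assms(1)
  by (simp add: topspace_eq_carrier)

text \<open>The complement is a union of left cosets of \<open>S\<close>, each open as a preimage of
  \<open>S\<close> under left multiplication.\<close>

lemma open_subgroup_closed: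
  assumes "subgroup S G" "openin T S"
  shows "closedin T S"
proof -
  have sub: "S \<subseteq> carrier G"
    by (simp add: assms(1) subgroup.subset)
  have "carrier G - S = (\<Union>a\<in>carrier G - S. {x \<in> carrier G. inv a \<otimes> x \<in> S})"
  proof (intro equalityI subsetI)
    fix x assume "x \<in> carrier G - S"
    then show "x \<in> (\<Union>a\<in>carrier G - S. {x \<in> carrier G. inv a \<otimes> x \<in> S})"
      using subgroup.one_closed [OF assms(1)] by (intro UN_I [of x]) auto
  next
    fix x assume "x \<in> (\<Union>a\<in>carrier G - S. {x \<in> carrier G. inv a \<otimes> x \<in> S})"
    then obtain a where a: "a \<in> carrier G" "a \<notin> S" "x \<in> carrier G" "inv a \<otimes> x \<in> S"
      by auto
    have "a = x \<otimes> inv (inv a \<otimes> x)"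
      using a by (simp add: inv_mult_group) (simp flip: m_assoc)
    then have "x \<notin> S"
      using a assms(1) by (metis subgroup.m_closed subgroup.m_inv_closed)
    with a show "x \<in> carrier G - S"
      by auto
  qed
  moreover have "openin T (\<Union>a\<in>carrier G - S. {x \<in> carrier G. inv a \<otimes> x \<in> S})"
    using assms(2) by (intro openin_Union) (auto intro: openin_left_preimage)
  ultimately show ?thesis
    by (simp add: closedin_def topspace_eq_carrier sub)
qed

text \<open>The right stabilizer of \<open>W\<close> is open by the tube lemma.\<close>

lemma compact_open_subgroup_within:
  assumes "openin T W" "compactin T W" "\<one> \<in> W"
  obtains U where "subgroup U G" "openin T U" "compactin T U" "U \<subseteq> W"
proof -
  define R where "R = {v \<in> carrier G. \<forall>w\<in>W. w \<otimes> v \<in> W}"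
  have WG: "W \<subseteq> carrier G"
    using assms(1) openin_subset topspace_eq_carrier by blast
  let ?P = "prod_topology (subtopology T W) T"
  have "continuous_map ?P T (\<lambda>p. fst p \<otimes> snd p)"
    by (intro continuous_mult_maps continuous_map_into_fulltopology [OF continuous_map_fst]
        continuous_map_snd)
  then have "closedin ?P {p \<in> topspace ?P. fst p \<otimes> snd p \<in> carrier G - W}"
    using assms(1) topspace_eq_carrier
    by (intro closedin_continuous_map_preimage) (auto simp: closedin_def Diff_Diff_Int WG inf.absorb2)
  then have "closedin T (snd ` {p \<in> topspace ?P. fst p \<otimes> snd p \<in> carrier G - W})"
    using Abstract_Topological_Spaces.closed_map_snd [OF compact_space_subtopology [OF assms(2)]]
    unfolding closed_map_def by blast
  moreover have "snd ` {p \<in> topspace ?P. fst p \<otimes> snd p \<in> carrier G - W} = carrier G - R"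
    using WG by (force simp: R_def topspace_eq_carrier image_iff)
  ultimately have openR: "openin T R"
    by (simp add: closedin_def topspace_eq_carrier Diff_Diff_Int R_def inf.absorb2 Collect_restrict)
  \<comment> \<open>\<open>R\<close> is only a monoid; its symmetric part is a group, and lies in
    \<open>W\<close> because \<open>\<one> \<in> W\<close>.\<close>
  define U where "U = R \<inter> {v \<in> carrier G. inv v \<in> R}"
  have "openin T U"
    using openR openin_continuous_map_preimage [OF continuous_inv openR]
    by (simp add: U_def topspace_eq_carrier openin_Int)
  moreover have "subgroup U G"
  proof (rule subgroupI)
    show "U \<subseteq> carrier G" "\<And>a. a \<in> U \<Longrightarrow> inv a \<in> U"
      by (auto simp: U_def R_def)
    have "\<one> \<in> U"
      using WG by (auto simp: U_def R_def)
    then show "U \<noteq> {}" by auto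
    fix a b assume "a \<in> U" "b \<in> U"
    then have "a \<in> carrier G" "b \<in> carrier G"
      and "\<And>w. w \<in> W \<Longrightarrow> w \<otimes> a \<otimes> b \<in> W" "\<And>w. w \<in> W \<Longrightarrow> w \<otimes> inv b \<otimes> inv a \<in> W"
      by (auto simp: U_def R_def)
    then show "a \<otimes> b \<in> U"
      using WG by (auto simp: U_def R_def inv_mult_group subset_iff m_assoc)
  qed
  moreover have "U \<subseteq> W"
    using assms(3) by (force simp: U_def R_def)
  moreover have "compactin T U"
    using calculation assms(2) closed_compactin open_subgroup_closed by blast
  ultimately show ?thesis
    using that by blast
qed

end

section \<open>Open sets of the group read off from the action\<close>

context tdlc_weakly_decomposable
begin

text \<open>A nonempty transporter is a left coset of the stabilizer of \<open>\<xi>\<close>. The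
  element \<open>bot\<close>, which \<open>open_stabilizer\<close> excludes, is fixed by the whole
  group.\<close>

lemma openin_transporter: "openin T {y \<in> carrier G. \<phi> y \<xi> = \<eta>}"
proof (cases "\<exists>y\<in>carrier G. \<phi> y \<xi> = \<eta>")
  case True
  then obtain a where a: "a \<in> carrier G" "\<phi> a \<xi> = \<eta>"
    by blast
  have "openin T (stabilizer G \<phi> \<xi>)"
  proof (cases "\<xi> = bot")
    case True
    then have "stabilizer G \<phi> \<xi> = topspace T"
      by (auto simp: stabilizer_def topspace_eq_carrier)
    then show ?thesis by simp
  qed (rule open_stabilizer)
  then have "openin T {y \<in> carrier G. inv a \<otimes> y \<in> stabilizer G \<phi> \<xi>}"
    by (simp add: a openin_left_preimage)
  moreover have "{y \<in> carrier G. inv a \<otimes> y \<in> stabilizer G \<phi> \<xi>} = {y \<in> carrier G. \<phi> y \<xi> = \<eta>}"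
    using a by (auto simp: stabilizer_def act_mult) (metis act_act_inv)
  ultimately show ?thesis by simp
next
  case False
  then have "{y \<in> carrier G. \<phi> y \<xi> = \<eta>} = {}" by auto
  then show ?thesis by (simp only: openin_empty)
qed

lemma openin_moving: "openin T {y \<in> carrier G. \<phi> y \<xi> \<noteq> \<xi>}"
proof -
  have "{y \<in> carrier G. \<phi> y \<xi> \<noteq> \<xi>} = (\<Union>\<eta>\<in>-{\<xi>}. {y \<in> carrier G. \<phi> y \<xi> = \<eta>})"
    by auto
  then show ?thesis
    by (simp only:) (auto intro: openin_transporter)
qed

lemma closedin_fixing: "closedin T {y \<in> carrier G. \<phi> y \<xi> = \<xi>}"
proof -
  have "carrier G - {y \<in> carrier G. \<phi> y \<xi> = \<xi>} = {y \<in> carrier G. \<phi> y \<xi> \<noteq> \<xi>}"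
    by auto
  then show ?thesis
    by (simp add: closedin_def topspace_eq_carrier openin_moving)
qed

lemma openin_fixator:
  assumes "finite F"
  shows "openin T {y \<in> carrier G. \<forall>\<xi>\<in>F. \<phi> y \<xi> = \<xi>}"
  using assms
proof induction
  case empty
  then show ?case
    using openin_topspace [of T] by (simp add: topspace_eq_carrier)
next
  case (insert \<xi> F)
  have "{y \<in> carrier G. \<forall>\<xi>'\<in>insert \<xi> F. \<phi> y \<xi>' = \<xi>'} =
        {y \<in> carrier G. \<phi> y \<xi> = \<xi>} \<inter> {y \<in> carrier G. \<forall>\<xi>\<in>F. \<phi> y \<xi> = \<xi>}"
    by auto
  with insert.IH show ?case
    by (simp add: openin_Int openin_transporter)
qed

text \<open>The open transporters of \<open>\<xi>\<close> cover \<open>K\<close>, so finitely many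
  targets suffice.\<close>

lemma finite_compact_orbit:
  assumes "compactin T K"
  shows "finite ((\<lambda>y. \<phi> y \<xi>) ` K)"
proof -
  have "K \<subseteq> (\<Union>\<eta>. {y \<in> carrier G. \<phi> y \<xi> = \<eta>})"
    using compactin_subset_topspace [OF assms] by (auto simp: topspace_eq_carrier)
  then obtain H where H: "finite H" "K \<subseteq> (\<Union>\<eta>\<in>H. {y \<in> carrier G. \<phi> y \<xi> = \<eta>})"
    by (rule compactin_finite_subcover_UN [OF assms openin_transporter]) auto
  then have "(\<lambda>y. \<phi> y \<xi>) ` K \<subseteq> H"
    by auto
  with H show ?thesis
    using finite_subset by blast
qed

text \<open>By faithfulness every element of the compact set \<open>K - S\<close> moves some
  \<open>\<xi>\<close>, which is an open condition; finitely many \<open>\<xi>\<close> therefore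
  detect all of \<open>K - S\<close>.\<close>

lemma fixator_within:
  assumes "compactin T K" "openin T S" "\<one> \<in> S"
  obtains F where "finite F" "{y \<in> K. \<forall>\<xi>\<in>F. \<phi> y \<xi> = \<xi>} \<subseteq> S"
proof -
  let ?V = "\<lambda>\<xi>. {y \<in> carrier G. \<phi> y \<xi> \<noteq> \<xi>}"
  have "closedin T (topspace T - S)"
    using assms(2) by blast
  then have KS: "compactin T (K - S)"
    using compact_Int_closedin [OF assms(1)] compactin_subset_topspace [OF assms(1)]
    by (metis Diff_eq Int_absorb2 inf_assoc)
  have "K - S \<subseteq> (\<Union>\<xi>. ?V \<xi>)"
  proof
    fix y assume "y \<in> K - S"
    then have "y \<in> carrier G" "y \<noteq> \<one>"
      using compactin_subset_topspace [OF assms(1)] assms(3) topspace_eq_carrier by auto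
    then show "y \<in> (\<Union>\<xi>. ?V \<xi>)"
      by (auto elim: faithfulE)
  qed
  then obtain F where F: "finite F" "K - S \<subseteq> (\<Union>\<xi>\<in>F. ?V \<xi>)"
    by (rule compactin_finite_subcover_UN [OF KS openin_moving])
  show ?thesis
    by (rule that [OF F(1)]) (use F(2) in blast)
qed

text \<open>A suitable finite fixator \<open>H\<close> meets the compact neighbourhood
  \<open>K\<close> only inside the open set \<open>S\<close>, so
  \<open>K \<inter> H = S \<inter> H\<close> is compact and open, and contains the desired
  group.\<close>

lemma exists_compact_open_subgroup:
  obtains U where "subgroup U G" "openin T U" "compactin T U"
proof -
  obtain S K where SK: "openin T S" "compactin T K" "\<one> \<in> S" "S \<subseteq> K"
    using locally_compact one_closed unfolding locally_compact_space_def topspace_eq_carrier by metis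
  obtain F where F: "finite F" "{y \<in> K. \<forall>\<xi>\<in>F. \<phi> y \<xi> = \<xi>} \<subseteq> S"
    by (rule fixator_within [OF SK(2,1,3)])
  define H where "H = {y \<in> carrier G. \<forall>\<xi>\<in>F. \<phi> y \<xi> = \<xi>}"
  have "subgroup H G"
    by (intro subgroupI) (auto simp: H_def act_mult act_inv_fix intro: exI [of _ \<one>])
  moreover have H: "openin T H"
    unfolding H_def by (rule openin_fixator [OF F(1)])
  ultimately have "compactin T (K \<inter> H)"
    using SK(2) compact_Int_closedin open_subgroup_closed by blast
  moreover have "K \<inter> H = S \<inter> H"
    using SK(4) F(2) by (auto simp: H_def)
  ultimately have "compactin T (S \<inter> H)"
    by simp
  moreover have "openin T (S \<inter> H)" "\<one> \<in> S \<inter> H"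
    using SK H by (auto simp: openin_Int H_def)
  ultimately obtain U where "subgroup U G" "openin T U" "compactin T U"
    using compact_open_subgroup_within by metis
  then show ?thesis
    using that by blast
qed

text \<open>Otherwise \<open>\<one>\<close> would be isolated in \<open>rist \<alpha>\<close>, and
  by left translation so would every point, contradicting \<open>non_discrete\<close>.\<close>

lemma rist_nontrivial:
  assumes "openin T S" "\<one> \<in> S" "\<alpha> \<noteq> bot"
  obtains z where "z \<in> rist \<alpha>" "z \<in> S" "z \<noteq> \<one>"
proof -
  have "\<exists>z\<in>rist \<alpha>. z \<in> S \<and> z \<noteq> \<one>"
  proof (rule ccontr)
    assume none: "\<not> ?thesis"
    have "openin (subtopology T (rist \<alpha>)) {s}" if s: "s \<in> rist \<alpha>" for s
    proof -
      have sG: "s \<in> carrier G"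
        using s rist_carrier by blast
      have "y = s" if "y \<in> rist \<alpha>" "inv s \<otimes> y \<in> S" for y
      proof -
        have "inv s \<otimes> y \<in> rist \<alpha>"
          using s that unfolding pointwise_stabilizer_def by (auto simp: act_mult) (metis act_inv_act)
        then have "inv s \<otimes> y = \<one>"
          using none that by blast
        then show "y = s"
          using sG rist_carrier that by (metis inv_closed inv_comm inv_equality inv_inv)
      qed
      then have "{s} = {y \<in> carrier G. inv s \<otimes> y \<in> S} \<inter> rist \<alpha>"
        using sG s assms(2) by auto
      moreover have "openin T {y \<in> carrier G. inv s \<otimes> y \<in> S}"
        by (simp add: assms(1) openin_left_preimage sG)
      ultimately show ?thesis
        unfolding openin_subtopology by blast
    qed
    moreover have "topspace (subtopology T (rist \<alpha>)) = rist \<alpha>"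
      using rist_carrier by (auto simp: topspace_eq_carrier)
    ultimately have "discrete_topology (rist \<alpha>) = subtopology T (rist \<alpha>)"
      by (simp add: discrete_topology_unique)
    then show False
      using non_discrete [OF assms(3)] by (simp add: Let_def)
  qed
  with that show ?thesis by blast
qed

text \<open>The algebra is atomless: a nontrivial element of \<open>rist \<alpha>\<close> displaces
  some nonzero \<open>\<beta> \<le> \<alpha>\<close> but fixes \<open>\<alpha>\<close>.\<close>

lemma exists_smaller:
  fixes \<alpha> :: 'b
  assumes "\<alpha> \<noteq> bot"
  obtains \<beta> where "\<beta> \<noteq> bot" "\<beta> < \<alpha>"
proof -
  obtain z where z: "z \<in> rist \<alpha>" "z \<noteq> \<one>"
    by (rule rist_nontrivial [OF openin_topspace _ assms]) (auto simp: topspace_eq_carrier)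
  then obtain \<beta> where \<beta>: "\<beta> \<noteq> bot" "inf \<beta> (\<phi> z \<beta>) = bot" "\<And>\<gamma>. z \<in> rist \<gamma> \<Longrightarrow> \<beta> \<le> \<gamma>"
    using exists_displaced rist_carrier by metis
  have "\<beta> \<noteq> \<alpha>"
    using \<beta> rist_fix [OF z(1)] by auto
  with \<beta> z(1) that show ?thesis
    by (simp add: less_le)
qed

end

section \<open>Contraction groups\<close>

context group
begin

text \<open>Integer exponents make backward orbits available next to the forward orbits used in
  \<open>con\<close>.\<close>

definition conj_pow :: "'a \<Rightarrow> int \<Rightarrow> 'a \<Rightarrow> 'a" where
  "conj_pow g n x = g [^] n \<otimes> x \<otimes> inv (g [^] n)"

lemma conj_pow_closed [simp]: "g \<in> carrier G \<Longrightarrow> x \<in> carrier G \<Longrightarrow> conj_pow g n x \<in> carrier G"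
  by (simp add: conj_pow_def)

lemma conj_pow_0 [simp]: "x \<in> carrier G \<Longrightarrow> conj_pow g 0 x = x"
  by (simp add: conj_pow_def)

lemma conj_pow_conj_pow: "g \<in> carrier G \<Longrightarrow> x \<in> carrier G \<Longrightarrow> conj_pow g m (conj_pow g n x) = conj_pow g (m + n) x"
  by (simp add: conj_pow_def conj_conj int_pow_mult)

lemma conj_pow_mult:
  "g \<in> carrier G \<Longrightarrow> x \<in> carrier G \<Longrightarrow> y \<in> carrier G \<Longrightarrow> conj_pow g n (x \<otimes> y) = conj_pow g n x \<otimes> conj_pow g n y"
  by (simp add: conj_pow_def conj_mult)

lemma conj_pow_inv: "g \<in> carrier G \<Longrightarrow> x \<in> carrier G \<Longrightarrow> conj_pow g n (inv x) = inv (conj_pow g n x)"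
  by (simp add: conj_pow_def conj_inv)

lemma conj_pow_one [simp]: "g \<in> carrier G \<Longrightarrow> conj_pow g n \<one> = \<one>"
  by (simp add: conj_pow_def)

lemma conj_pow_inv_base: "g \<in> carrier G \<Longrightarrow> conj_pow (inv g) n x = conj_pow g (- n) x"
  by (simp add: conj_pow_def int_pow_inv int_pow_neg)

end

context tdlc_weakly_decomposable
begin

lemma con_altdef:
  "con G T g = {x \<in> carrier G. limitin T (\<lambda>n. conj_pow g (int n) x) \<one> sequentially}"
  by (simp add: con_def conj_pow_def int_pow_int)

lemma con_carrier: "x \<in> con G T g \<Longrightarrow> x \<in> carrier G"
  by (simp add: con_def)

lemma continuous_conj_pow: "g \<in> carrier G \<Longrightarrow> continuous_map T T (conj_pow g n)"
  using continuous_conj [of "g [^] n"] by (simp add: conj_pow_def [abs_def])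

lemma rist_conj_pow: "g \<in> carrier G \<Longrightarrow> z \<in> rist \<alpha> \<Longrightarrow> conj_pow g n z \<in> rist (\<phi> (g [^] n) \<alpha>)"
  by (simp add: conj_pow_def rist_conj)

lemma conj_pow_con:
  assumes "g \<in> carrier G" "x \<in> con G T g"
  shows "conj_pow g k x \<in> con G T g"
proof -
  have x: "x \<in> carrier G"
    using assms(2) con_carrier by blast
  have "limitin T (conj_pow g k \<circ> (\<lambda>n. conj_pow g (int n) x)) (conj_pow g k \<one>) sequentially"
    using assms by (intro continuous_map_limit [OF continuous_conj_pow]) (auto simp: con_altdef)
  then show ?thesis
    using assms(1) x by (simp add: con_altdef o_def conj_pow_conj_pow add.commute)
qed

section \<open>Contraction groups tested in a compact open subgroup\<close>

context
  fixes U :: "'a set"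
  assumes sub: "subgroup U G" and openU: "openin T U" and compactU: "compactin T U"
begin

text \<open>Inside the compact group \<open>U\<close>, fixators of finite sets are arbitrarily small
  neighbourhoods of \<open>\<one>\<close>, so convergence can be checked on one \<open>\<xi>\<close>
  at a time.\<close>

lemma con_iff:
  assumes g: "g \<in> carrier G"
  shows "x \<in> con G T g \<longleftrightarrow> x \<in> carrier G \<and> (\<forall>\<^sub>F n in sequentially. conj_pow g (int n) x \<in> U) \<and>
           (\<forall>\<xi>. \<forall>\<^sub>F n in sequentially. \<phi> (conj_pow g (int n) x) \<xi> = \<xi>)" (is "?L \<longleftrightarrow> ?R")
proof
  assume ?L
  then have x: "x \<in> carrier G" and lim: "limitin T (\<lambda>n. conj_pow g (int n) x) \<one> sequentially"
    by (auto simp: con_altdef)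
  have "\<forall>\<^sub>F n in sequentially. conj_pow g (int n) x \<in> U"
    using lim openU subgroup.one_closed [OF sub] by (simp add: limitin_def)
  moreover have "\<forall>\<^sub>F n in sequentially. \<phi> (conj_pow g (int n) x) \<xi> = \<xi>" for \<xi>
  proof -
    have "\<forall>\<^sub>F n in sequentially. conj_pow g (int n) x \<in> {y \<in> carrier G. \<phi> y \<xi> = \<xi>}"
      by (rule lim [unfolded limitin_def, THEN conjunct2, rule_format]) (simp add: openin_transporter)
    then show ?thesis
      by (rule eventually_mono) simp
  qed
  ultimately show ?R
    using x by blast
next
  assume R: ?R
  have "\<forall>\<^sub>F n in sequentially. conj_pow g (int n) x \<in> S" if S: "openin T S" "\<one> \<in> S" for S
  proof -
    from compactU S obtain F where F: "finite F" "{y \<in> U. \<forall>\<xi>\<in>F. \<phi> y \<xi> = \<xi>} \<subseteq> S"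
      by (rule fixator_within)
    have "\<forall>\<^sub>F n in sequentially. \<forall>\<xi>\<in>F. \<phi> (conj_pow g (int n) x) \<xi> = \<xi>"
      using F(1) R by (simp add: eventually_ball_finite)
    then have "\<forall>\<^sub>F n in sequentially. conj_pow g (int n) x \<in> U \<and> (\<forall>\<xi>\<in>F. \<phi> (conj_pow g (int n) x) \<xi> = \<xi>)"
      using R by (simp add: eventually_conj)
    then show ?thesis
      by (rule eventually_mono) (use F(2) in blast)
  qed
  then show ?L
    using R by (simp add: con_altdef limitin_def topspace_eq_carrier)
qed

lemma con_mult:
  assumes g: "g \<in> carrier G" and xy: "x \<in> con G T g" "y \<in> con G T g"
  shows "x \<otimes> y \<in> con G T g"
proof -
  have G: "x \<in> carrier G" "y \<in> carrier G"
    using xy con_carrier by auto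
  have "\<forall>\<^sub>F n in sequentially. conj_pow g (int n) x \<in> U" "\<forall>\<^sub>F n in sequentially. conj_pow g (int n) y \<in> U"
    using xy [unfolded con_iff [OF g]] by auto
  then have "\<forall>\<^sub>F n in sequentially. conj_pow g (int n) (x \<otimes> y) \<in> U"
    by eventually_elim (simp add: conj_pow_mult g G subgroup.m_closed [OF sub])
  moreover have "\<forall>\<^sub>F n in sequentially. \<phi> (conj_pow g (int n) (x \<otimes> y)) \<xi> = \<xi>" for \<xi>
  proof -
    have "\<forall>\<^sub>F n in sequentially. \<phi> (conj_pow g (int n) x) \<xi> = \<xi>" "\<forall>\<^sub>F n in sequentially. \<phi> (conj_pow g (int n) y) \<xi> = \<xi>"
      using xy [unfolded con_iff [OF g]] by auto
    then show ?thesis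
      by eventually_elim (simp add: conj_pow_mult act_mult g G)
  qed
  ultimately show ?thesis
    by (simp add: con_iff g G)
qed

text \<open>Inverses of the conjugates of \<open>z\<close> send \<open>\<xi>\<close> into its finite
  \<open>U\<close>-orbit, and the conjugates of \<open>x\<close> eventually fix that whole
  orbit.\<close>

lemma con_conj:
  assumes g: "g \<in> carrier G" and x: "x \<in> con G T g"
    and z: "z \<in> carrier G" "\<And>n::nat. conj_pow g (int n) z \<in> U"
  shows "z \<otimes> x \<otimes> inv z \<in> con G T g"
proof -
  have G: "x \<in> carrier G"
    using x con_carrier by auto
  have conj_pow_eq: "conj_pow g n (z \<otimes> x \<otimes> inv z) = conj_pow g n z \<otimes> conj_pow g n x \<otimes> inv (conj_pow g n z)" for n
    by (simp add: conj_pow_mult conj_pow_inv g z G)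
  have "\<forall>\<^sub>F n in sequentially. conj_pow g (int n) x \<in> U"
    using x [unfolded con_iff [OF g]] by auto
  then have "\<forall>\<^sub>F n in sequentially. conj_pow g (int n) (z \<otimes> x \<otimes> inv z) \<in> U"
    by eventually_elim (simp add: conj_pow_eq z subgroup.m_closed [OF sub] subgroup.m_inv_closed [OF sub])
  moreover have "\<forall>\<^sub>F n in sequentially. \<phi> (conj_pow g (int n) (z \<otimes> x \<otimes> inv z)) \<xi> = \<xi>" for \<xi>
  proof -
    have "finite ((\<lambda>u. \<phi> u \<xi>) ` U)"
      using compactU finite_compact_orbit by blast
    then have "\<forall>\<^sub>F n in sequentially. \<forall>\<eta>\<in>(\<lambda>u. \<phi> u \<xi>) ` U. \<phi> (conj_pow g (int n) x) \<eta> = \<eta>"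
      using x [unfolded con_iff [OF g]] by (intro eventually_ball_finite) auto
    then show ?thesis
    proof eventually_elim
      case (elim n)
      then have "\<phi> (conj_pow g (int n) x) (\<phi> (inv (conj_pow g (int n) z)) \<xi>) = \<phi> (inv (conj_pow g (int n) z)) \<xi>"
        using z(2) subgroup.m_inv_closed [OF sub] by blast
      then show ?case
        by (simp add: conj_pow_eq act_conj_eq_iff g G z)
    qed
  qed
  ultimately show ?thesis
    by (simp add: con_iff g G z)
qed

lemma con_inv:
  assumes g: "g \<in> carrier G" and x: "x \<in> con G T g"
  shows "inv x \<in> con G T g"
proof -
  have G: "x \<in> carrier G"
    using x con_carrier by auto
  have "\<forall>\<^sub>F n in sequentially. conj_pow g (int n) x \<in> U"
    using x [unfolded con_iff [OF g]] by auto
  then have "\<forall>\<^sub>F n in sequentially. conj_pow g (int n) (inv x) \<in> U"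
    by eventually_elim (simp add: conj_pow_inv g G subgroup.m_inv_closed [OF sub])
  moreover have "\<forall>\<^sub>F n in sequentially. \<phi> (conj_pow g (int n) (inv x)) \<xi> = \<xi>" for \<xi>
  proof -
    have "\<forall>\<^sub>F n in sequentially. \<phi> (conj_pow g (int n) x) \<xi> = \<xi>"
      using x [unfolded con_iff [OF g]] by auto
    then show ?thesis
      by eventually_elim (simp add: conj_pow_inv g G act_inv_fix)
  qed
  ultimately show ?thesis
    by (simp add: con_iff g G)
qed

text \<open>If \<^term>\<open>con G T g\<close> were closed, the elements of \<^term>\<open>con G T g\<close> whose whole orbit under
  conjugation by \<^term>\<open>g\<close> stays in \<open>U\<close> would form a compact group \<open>C\<close>. By Baire, \<open>C\<close> is contracted
  uniformly into each open subgroup, which is absurd because conjugation by \<^term>\<open>g\<close> permutes \<open>C\<close>.\<close>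

lemma bounded_con_not_closed:
  assumes g: "g \<in> carrier G" and y: "y \<in> con G T g" "y \<noteq> \<one>" "\<And>n. conj_pow g n y \<in> U"
  shows "\<not> closedin T (con G T g)"
proof
  assume closed: "closedin T (con G T g)"
  obtain \<xi> where \<xi>: "\<phi> y \<xi> \<noteq> \<xi>"
    using y con_carrier faithfulE by metis
  define C where "C = {x \<in> con G T g. \<forall>n. conj_pow g n x \<in> U}"
  \<comment> \<open>By \<open>con_iff\<close>, \<open>C\<close> is the increasing union of these
    sets. They are closed, and stable under products and inverses, so interior in one of them can be
    translated around \<open>C\<close>.\<close>
  define D where "D n = {x \<in> C. \<forall>m\<ge>n. \<phi> (conj_pow g (int m) x) \<xi> = \<xi>}" for n :: nat
  have CG: "x \<in> carrier G" if "x \<in> C" for x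
    using that con_carrier by (auto simp: C_def)
  have closedU: "closedin T U"
    using open_subgroup_closed openU sub by blast
  have pre: "closedin T {x \<in> carrier G. conj_pow g n x \<in> S}" if "closedin T S" for n S
    using closedin_continuous_map_preimage [OF continuous_conj_pow [OF g] that]
    by (simp add: topspace_eq_carrier)
  have "C = con G T g \<inter> (\<Inter>n. {x \<in> carrier G. conj_pow g n x \<in> U})"
    using con_carrier by (auto simp: C_def)
  moreover have "closedin T (\<Inter>n. {x \<in> carrier G. conj_pow g n x \<in> U})"
    by (intro closedin_INT pre closedU) auto
  ultimately have closedC: "closedin T C"
    by (simp add: closed closedin_Int)
  have "C \<subseteq> U"
    using CG by (auto simp: C_def) (metis conj_pow_0)
  then have compactC: "compactin T C"
    using closedC closed_compactin compactU by blast
  have "D n = C \<inter> (\<Inter>m\<in>{n..}. {x \<in> carrier G. conj_pow g (int m) x \<in> {x \<in> carrier G. \<phi> x \<xi> = \<xi>}})" for n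
    using CG g by (auto simp: D_def)
  moreover have "closedin T (\<Inter>m\<in>{n..}. {x \<in> carrier G. conj_pow g (int m) x \<in> {x \<in> carrier G. \<phi> x \<xi> = \<xi>}})" for n
    by (intro closedin_INT pre closedin_fixing) auto
  ultimately have closedD: "closedin T (D n)" for n
    by (simp add: closedC closedin_Int)
  have D_mono: "D m \<subseteq> D n" if "m \<le> n" for m n
    using that by (auto simp: D_def)
  have C_D: "\<exists>n. x \<in> D n" if "x \<in> C" for x
    using that con_iff [OF g, of x] by (auto simp: C_def D_def eventually_sequentially)
  have C_mult: "a \<otimes> b \<in> C" if "a \<in> C" "b \<in> C" for a b
    using that con_mult [OF g] CG subgroup.m_closed [OF sub] by (auto simp: C_def conj_pow_mult g)
  have C_inv: "inv a \<in> C" if "a \<in> C" for a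
    using that con_inv [OF g] CG subgroup.m_inv_closed [OF sub] by (auto simp: C_def conj_pow_inv g)
  have D_mult: "a \<otimes> b \<in> D n" if "a \<in> D n" "b \<in> D n" for a b n
    using that C_mult CG by (auto simp: D_def conj_pow_mult act_mult g)
  have D_inv: "inv a \<in> D n" if "a \<in> D n" for a n
    using that C_inv CG by (auto simp: D_def conj_pow_inv g act_inv_fix)
  let ?X = "subtopology T C"
  have X: "topspace ?X = C"
    using closedC closedin_subset by auto
  have compactX: "compact_space ?X"
    by (simp add: compactC compact_space_subtopology)
  have "Hausdorff_space ?X"
    by (simp add: Hausdorff Hausdorff_space_subtopology)
  then have "regular_space ?X" "locally_compact_space ?X"
    using compactX by (simp_all add: compact_Hausdorff_imp_regular_space compact_imp_locally_compact_space)
  have "\<exists>n. ?X interior_of (D n) \<noteq> {}"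
  proof (rule ccontr)
    assume "\<not> ?thesis"
    moreover have "closedin ?X (D n)" for n
      using closedD by (simp add: closedin_subset_topspace D_def)
    ultimately have "?X interior_of \<Union>(range D) = {}"
      using \<open>regular_space ?X\<close> \<open>locally_compact_space ?X\<close> by (intro Baire_category_alt) auto
    moreover have "\<Union>(range D) = topspace ?X"
      unfolding X using C_D by (auto simp: D_def)
    ultimately have "C = {}"
      using X interior_of_topspace by metis
    then show False
      using y by (auto simp: C_def)
  qed
  then obtain n d where d: "d \<in> ?X interior_of (D n)"
    by blast
  then have dD: "d \<in> D n" and dC: "d \<in> C"
    using interior_of_subset [of ?X "D n"] by (auto simp: D_def)
  obtain S where S: "openin T S" "S \<inter> C = ?X interior_of (D n)"
    using openin_interior_of [of ?X "D n"] unfolding openin_subtopology by blast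
  \<comment> \<open>\<open>E a\<close> is the translate of \<open>S\<close> that moves
    \<open>d\<close> to \<open>a\<close>. A point \<open>x\<close> of \<open>C\<close> in it is
    recovered from \<open>a\<close>, \<open>d\<close> and an element of \<open>D n\<close>, which
    bounds its contraction time once finitely many \<open>a\<close> suffice.\<close>
  define E where "E a = {x \<in> carrier G. d \<otimes> inv a \<otimes> x \<in> S}" for a
  have "a \<in> E a" if "a \<in> C" for a
    using S(2) d CG [OF that] CG [OF dC] by (auto simp: E_def m_assoc)
  then have cover: "C \<subseteq> (\<Union>a\<in>C. E a)"
    by blast
  have openE: "openin T (E a)" if "a \<in> C" for a
    using that CG dC S(1) unfolding E_def by (intro openin_left_preimage) auto
  obtain J where J: "finite J" "J \<subseteq> C" "C \<subseteq> (\<Union>a\<in>J. E a)"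
    by (rule compactin_finite_subcover_UN [OF compactC openE cover])
  then have "\<forall>a\<in>J. \<exists>n. a \<in> D n"
    using C_D by blast
  then obtain N where N: "\<And>a. a \<in> J \<Longrightarrow> a \<in> D (N a)"
    by metis
  define M where "M = Max (insert n (N ` J))"
  have M: "n \<le> M" "\<And>a. a \<in> J \<Longrightarrow> N a \<le> M"
    using J(1) by (auto simp: M_def)
  have CD: "x \<in> D M" if x: "x \<in> C" for x
  proof -
    obtain a where a: "a \<in> J" "x \<in> E a"
      using J x by blast
    then have aC: "a \<in> C"
      using J by blast
    have "d \<otimes> inv a \<otimes> x \<in> S \<inter> C"
      using a aC dC x by (simp add: E_def C_mult C_inv)
    then have "d \<otimes> inv a \<otimes> x \<in> D M"
      using S(2) interior_of_subset [of ?X "D n"] D_mono [OF M(1)] by blast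
    moreover have "a \<in> D M" "d \<in> D M"
      using a M N D_mono dD by blast+
    ultimately have "a \<otimes> (inv d \<otimes> (d \<otimes> inv a \<otimes> x)) \<in> D M"
      by (blast intro: D_mult D_inv)
    moreover have "a \<otimes> (inv d \<otimes> (d \<otimes> inv a \<otimes> x)) = x"
      using CG aC dC x by (simp flip: m_assoc)
    ultimately show ?thesis
      by simp
  qed
  have yG: "y \<in> carrier G"
    using y con_carrier by blast
  \<comment> \<open>Shifting \<open>y\<close> back by \<open>M\<close> stays in \<open>C\<close>;
    after \<open>M\<close> steps the orbit is again at \<open>y\<close>, which would then have to
    fix \<open>\<xi>\<close>.\<close>
  have "conj_pow g (- int M) y \<in> C"
    using y yG by (simp add: C_def conj_pow_con conj_pow_conj_pow g)
  then have "conj_pow g (- int M) y \<in> D M"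
    by (rule CD)
  then have "\<phi> (conj_pow g (int M) (conj_pow g (- int M) y)) \<xi> = \<xi>"
    by (simp add: D_def)
  with \<xi> show False
    by (simp add: conj_pow_conj_pow g yG)
qed

end

end

section \<open>Wandering and compressed elements\<close>

context tdlc_weakly_decomposable
begin

lemma openin_conj_pow_preimage:
  assumes "g \<in> carrier G" "openin T S"
  shows "openin T {x \<in> carrier G. conj_pow g n x \<in> S}"
  using openin_continuous_map_preimage [OF continuous_conj_pow [OF assms(1)] assms(2)]
  by (simp add: topspace_eq_carrier)

text \<open>For large \<open>\<bar>n\<bar>\<close>, elements of \<open>U\<close> supported on the \<open>n\<close>-th translate of \<open>\<delta>\<close> are close to \<open>\<one>\<close>, so
  conjugation by \<open>g\<^sup>\<plusminus>\<^sup>1\<close> does not lead out of \<open>U\<close>; hence a small element of the rigid stabilizer of \<open>\<delta>\<close>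
  has its whole orbit in \<open>U\<close>.\<close>

lemma wandering_imp_con_not_closed:
  assumes g: "g \<in> carrier G" and "\<delta> \<noteq> bot"
    and disj: "\<And>m n::int. m \<noteq> n \<Longrightarrow> inf (\<phi> (g [^] m) \<delta>) (\<phi> (g [^] n) \<delta>) = bot"
  shows "\<not> closedin T (con G T g)"
proof -
  obtain U where U: "subgroup U G" "openin T U" "compactin T U"
    by (rule exists_compact_open_subgroup)
  define \<delta>' where "\<delta>' n = \<phi> (g [^] n) \<delta>" for n :: int
  define B where "B \<xi> = {n. \<exists>u\<in>U. u \<in> rist (\<delta>' n) \<and> \<phi> u \<xi> \<noteq> \<xi>}" for \<xi>
  have finB: "finite (B \<xi>)" for \<xi>
  proof -
    have "\<forall>n\<in>B \<xi>. \<exists>u. u \<in> U \<and> u \<in> rist (\<delta>' n) \<and> \<phi> u \<xi> \<noteq> \<xi>"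
      by (auto simp: B_def)
    then obtain u where u: "\<And>n. n \<in> B \<xi> \<Longrightarrow> u n \<in> U \<and> u n \<in> rist (\<delta>' n) \<and> \<phi> (u n) \<xi> \<noteq> \<xi>"
      by metis
    \<comment> \<open>Equal images for two exponents would put the same displacement of
      \<open>\<xi>\<close> below two disjoint translates, forcing it to vanish.\<close>
    have "inj_on (\<lambda>n. \<phi> (u n) \<xi>) (B \<xi>)"
    proof (rule inj_onI, rule ccontr)
      fix m n assume mn: "m \<in> B \<xi>" "n \<in> B \<xi>" "\<phi> (u m) \<xi> = \<phi> (u n) \<xi>" "m \<noteq> n"
      have disj': "\<eta> = bot" if "\<eta> \<le> \<delta>' m" "\<eta> \<le> \<delta>' n" for \<eta>
        using that disj [OF mn(4)] by (metis \<delta>'_def bot_unique le_inf_iff)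
      have "\<phi> (u m) \<xi> - \<xi> = bot" "\<xi> - \<phi> (u m) \<xi> = bot"
        using mn u rist_displacement [of "u m" "\<delta>' m" \<xi>] rist_displacement [of "u n" "\<delta>' n" \<xi>]
        by (auto intro!: disj' simp del: diff_shunt_var)
      then show False
        using u [OF mn(1)] by (simp add: order_antisym)
    qed
    moreover have "(\<lambda>n. \<phi> (u n) \<xi>) ` B \<xi> \<subseteq> (\<lambda>v. \<phi> v \<xi>) ` U"
      using u by blast
    ultimately show ?thesis
      using finite_compact_orbit [OF U(3)] by (meson finite_imageD finite_subset)
  qed
  define S where "S = {x \<in> carrier G. conj_pow g 1 x \<in> U} \<inter> {x \<in> carrier G. conj_pow g (- 1) x \<in> U}"
  have "openin T S" "\<one> \<in> S"
    using subgroup.one_closed [OF U(1)] openin_conj_pow_preimage [OF g U(2)] by (auto simp: S_def g openin_Int)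
  then obtain F where F: "finite F" "{y \<in> U. \<forall>\<xi>\<in>F. \<phi> y \<xi> = \<xi>} \<subseteq> S"
    by (rule fixator_within [OF U(3)])
  have "finite (\<Union>\<xi>\<in>F. (\<lambda>n. nat \<bar>n\<bar>) ` B \<xi>)"
    using F(1) finB by blast
  then obtain N where N: "\<And>\<xi> n. \<xi> \<in> F \<Longrightarrow> n \<in> B \<xi> \<Longrightarrow> nat \<bar>n\<bar> < N"
    unfolding finite_nat_set_iff_bounded by blast
  have large: "u \<in> S" if "u \<in> U" "u \<in> rist (\<delta>' n)" "\<bar>n\<bar> \<ge> int N" for u n
  proof -
    have "n \<notin> B \<xi>" if "\<xi> \<in> F" for \<xi>
      using N [OF that, of n] \<open>\<bar>n\<bar> \<ge> int N\<close> by auto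
    then show ?thesis
      using that(1,2) F(2) by (auto simp: B_def)
  qed
  \<comment> \<open>Smallness of \<open>z\<close> has to control only the window from
    \<open>-N\<close> to \<open>N\<close>; beyond it \<open>large\<close> extends the orbit inside
    \<open>U\<close> one step at a time.\<close>
  have openI: "openin T (\<Inter>n\<in>{- int N..int N}. {x \<in> carrier G. conj_pow g n x \<in> U})"
    using openin_conj_pow_preimage [OF g U(2)] by (intro openin_Inter) auto
  have oneI: "\<one> \<in> (\<Inter>n\<in>{- int N..int N}. {x \<in> carrier G. conj_pow g n x \<in> U})"
    using subgroup.one_closed [OF U(1)] by (simp add: g)
  obtain z where z: "z \<in> rist \<delta>" "z \<noteq> \<one>"
    and "z \<in> (\<Inter>n\<in>{- int N..int N}. {x \<in> carrier G. conj_pow g n x \<in> U})"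
    by (rule rist_nontrivial [OF openI oneI \<open>\<delta> \<noteq> bot\<close>])
  then have z_mid: "\<And>n. n \<in> {- int N..int N} \<Longrightarrow> conj_pow g n z \<in> U"
    by blast
  have zG: "z \<in> carrier G"
    using z(1) rist_carrier by blast
  have z_rist: "conj_pow g n z \<in> rist (\<delta>' n)" for n
    unfolding \<delta>'_def by (rule rist_conj_pow [OF g z(1)])
  have tail: "conj_pow g (int N + int k) z \<in> U \<and> conj_pow g (- int N - int k) z \<in> U" for k
  proof (induction k)
    case 0
    then show ?case
      using z_mid by simp
  next
    case (Suc k)
    have "conj_pow g (int N + int k) z \<in> S" "conj_pow g (- int N - int k) z \<in> S"
      using Suc by (auto intro!: large z_rist)
    moreover have shift: "int N + int (Suc k) = 1 + (int N + int k)"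
      "- int N - int (Suc k) = - 1 + (- int N - int k)"
      by auto
    ultimately show ?case
      unfolding shift by (simp add: S_def conj_pow_conj_pow g zG)
  qed
  have bounded: "conj_pow g n z \<in> U" for n
  proof -
    consider "n \<in> {- int N..int N}" | "n = int N + int (nat (n - int N))" | "n = - int N - int (nat (- n - int N))"
      by (cases "\<bar>n\<bar> \<le> int N"; cases "n \<ge> 0") auto
    then show ?thesis
      using z_mid tail by cases metis+
  qed
  have "\<forall>\<^sub>F n in sequentially. \<phi> (conj_pow g (int n) z) \<xi> = \<xi>" for \<xi>
  proof -
    have "finite {n. int n \<in> B \<xi>}"
      using finite_vimageI [OF finB inj_of_nat] by (simp add: vimage_def)
    then have "\<forall>\<^sub>F n in sequentially. int n \<notin> B \<xi>"
      by (simp flip: cofinite_eq_sequentially add: eventually_cofinite)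
    then show ?thesis
      by eventually_elim (use bounded z_rist in \<open>auto simp: B_def\<close>)
  qed
  then have "z \<in> con G T g"
    using con_iff [OF U g] zG bounded by simp
  then show ?thesis
    using bounded_con_not_closed [OF U g] z(2) bounded by blast
qed

text \<open>The translates of \<open>\<sigma>\<close> descend, so the differences of consecutive
  terms, which are the translates of \<open>\<sigma> - \<phi> h \<sigma>\<close>, are pairwise
  disjoint.\<close>

lemma compressing_imp_con_not_closed:
  assumes h: "h \<in> carrier G" and less: "\<phi> h \<sigma> < \<sigma>"
  shows "\<not> closedin T (con G T h)"
proof (rule wandering_imp_con_not_closed [OF h])
  show "\<sigma> - \<phi> h \<sigma> \<noteq> bot"
    using less by (simp add: diff_shunt_var less_le_not_le)
  have le: "\<phi> (h [^] int k) \<sigma> \<le> \<sigma>" for k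
  proof (induction k)
    case (Suc k)
    have "h [^] int (Suc k) = h \<otimes> h [^] int k"
      by (simp add: h int_pow_mult)
    then have "\<phi> (h [^] int (Suc k)) \<sigma> = \<phi> h (\<phi> (h [^] int k) \<sigma>)"
      by (simp add: act_mult h)
    also have "\<dots> \<le> \<phi> h \<sigma>"
      using Suc h by simp
    finally show ?case
      using less by simp
  qed simp
  have anti: "\<phi> (h [^] n) \<sigma> \<le> \<phi> (h [^] m) \<sigma>" if "m \<le> n" for m n :: int
  proof -
    have "h [^] n = h [^] m \<otimes> h [^] int (nat (n - m))"
      using that h by (simp flip: int_pow_mult)
    then show ?thesis
      using le [of "nat (n - m)"] h by (simp add: act_mult)
  qed
  have *: "inf (\<phi> (h [^] m) (\<sigma> - \<phi> h \<sigma>)) (\<phi> (h [^] n) (\<sigma> - \<phi> h \<sigma>)) = bot" if "m < n" for m n :: int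
  proof -
    have "\<phi> (h [^] m) (\<phi> h \<sigma>) = \<phi> (h [^] (m + 1)) \<sigma>"
      by (simp add: h act_mult int_pow_mult)
    then have "\<phi> (h [^] m) (\<sigma> - \<phi> h \<sigma>) \<le> - \<phi> (h [^] (m + 1)) \<sigma>"
      by (simp only: act_diff h int_pow_closed) (simp add: diff_eq)
    moreover have "\<phi> (h [^] n) (\<sigma> - \<phi> h \<sigma>) \<le> \<phi> (h [^] (m + 1)) \<sigma>"
    proof (rule order_trans)
      show "\<phi> (h [^] n) (\<sigma> - \<phi> h \<sigma>) \<le> \<phi> (h [^] n) \<sigma>"
        by (simp add: h diff_eq)
      show "\<phi> (h [^] n) \<sigma> \<le> \<phi> (h [^] (m + 1)) \<sigma>"
        using that by (intro anti) simp
    qed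
    ultimately have "inf (\<phi> (h [^] m) (\<sigma> - \<phi> h \<sigma>)) (\<phi> (h [^] n) (\<sigma> - \<phi> h \<sigma>))
        \<le> inf (- \<phi> (h [^] (m + 1)) \<sigma>) (\<phi> (h [^] (m + 1)) \<sigma>)"
      by (rule inf_mono)
    then show ?thesis
      by (simp add: bot_unique)
  qed
  show "inf (\<phi> (h [^] m) (\<sigma> - \<phi> h \<sigma>)) (\<phi> (h [^] n) (\<sigma> - \<phi> h \<sigma>)) = bot" if "m \<noteq> n" for m n :: int
    using * [of m n] * [of n m] that by (metis inf_commute linorder_neqE)
qed

text \<open>When an orbit leaves \<open>V\<close>, its last point inside \<open>V\<close> displaces an element of \<open>\<phi> (inv g) ` F\<close>. As
  \<open>U\<close>-orbits are finite, only finitely many displacements \<open>\<sigma>\<close> occur, and \<open>\<sigma>\<close> lies below the support.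
  So every nonzero element below \<open>\<beta>\<^sub>0\<close> dominates some \<open>\<phi> (g [^] - j) \<sigma>\<close>, and by the pigeonhole principle a
  descending sequence of such elements contains one element compressed by a power of \<open>g\<close>.\<close>

lemma escaping_imp_con_not_closed:
  assumes U: "compactin T U" and g: "g \<in> carrier G" and "finite F"
    and V: "V = {v \<in> U. \<forall>\<xi>\<in>F. \<phi> v \<xi> = \<xi>}" and VU: "\<And>v. v \<in> V \<Longrightarrow> conj_pow g 1 v \<in> U"
    and "\<beta>\<^sub>0 \<noteq> bot"
    and esc: "\<And>\<beta>. \<beta> \<noteq> bot \<Longrightarrow> \<beta> \<le> \<beta>\<^sub>0 \<Longrightarrow> \<exists>z\<in>rist \<beta> \<inter> V. \<exists>n::nat. conj_pow g (int n) z \<notin> V"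
  shows "\<exists>h\<in>carrier G. \<not> closedin T (con G T h)"
proof -
  \<comment> \<open>Displacements are recorded as symmetric differences; \<open>bot\<close> is
    removed so that every element found can be shrunk further.\<close>
  define \<D> where "\<D> = (\<Union>\<xi>\<in>\<phi> (inv g) ` F. (\<lambda>\<eta>. sup (\<eta> - \<xi>) (\<xi> - \<eta>)) ` (\<lambda>y. \<phi> y \<xi>) ` U) - {bot}"
  have "finite \<D>"
    unfolding \<D>_def using finite_compact_orbit [OF U] \<open>finite F\<close> by blast
  define \<tau> where "\<tau> = (\<lambda>(j::nat, \<sigma>). \<phi> (g [^] (- int j)) \<sigma>)"
  have below: "\<exists>p. snd p \<in> \<D> \<and> \<tau> p \<le> \<beta>" if \<beta>: "\<beta> \<noteq> bot" "\<beta> \<le> \<beta>\<^sub>0" for \<beta>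
  proof -
    obtain z n where z: "z \<in> rist \<beta>" "z \<in> V" "conj_pow g (int n) z \<notin> V"
      using esc [OF \<beta>] by blast
    have zG: "z \<in> carrier G"
      using z(1) rist_carrier by blast
    have "\<exists>j. conj_pow g (int j) z \<in> V \<and> conj_pow g (int (Suc j)) z \<notin> V"
    proof (rule ccontr)
      assume "\<not> ?thesis"
      then have "conj_pow g (int n) z \<in> V"
        using z(2) zG by (induction n) auto
      with z(3) show False by blast
    qed
    then obtain j where j: "conj_pow g (int j) z \<in> V" "conj_pow g (int (Suc j)) z \<notin> V"
      by blast
    define y where "y = conj_pow g (int j) z"
    have yG: "y \<in> carrier G" and y_rist: "y \<in> rist (\<phi> (g [^] int j) \<beta>)"
      using z(1) zG g rist_conj_pow by (auto simp: y_def)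
    have y1: "conj_pow g 1 y = conj_pow g (int (Suc j)) z"
      by (simp add: y_def conj_pow_conj_pow g zG add.commute)
    \<comment> \<open>By \<open>VU\<close> the next point is still in \<open>U\<close>, so it leaves
      \<open>V\<close> by moving some \<open>f\<close>; equivalently, \<open>y\<close> moves the
      image of \<open>f\<close> under \<open>inv g\<close>.\<close>
    then obtain f where f: "f \<in> F" "\<phi> (conj_pow g 1 y) f \<noteq> f"
      using j VU [of y] by (auto simp: V y_def)
    define \<xi> where "\<xi> = \<phi> (inv g) f"
    have ne: "\<phi> y \<xi> \<noteq> \<xi>"
      using f(2) act_conj_eq_iff [OF g yG, of f] by (simp add: conj_pow_def g \<xi>_def)
    define \<sigma> where "\<sigma> = sup (\<phi> y \<xi> - \<xi>) (\<xi> - \<phi> y \<xi>)"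
    have "\<sigma> \<noteq> bot"
      using ne by (auto simp: \<sigma>_def diff_shunt_var sup_eq_bot_iff)
    then have "\<sigma> \<in> \<D>"
      using f(1) j(1) unfolding \<D>_def \<sigma>_def \<xi>_def V y_def by blast
    have "\<sigma> \<le> \<phi> (g [^] int j) \<beta>"
      using rist_displacement [OF y_rist] by (simp add: \<sigma>_def)
    then have "\<phi> (g [^] (- int j)) \<sigma> \<le> \<beta>"
      using g by (metis act_inv_act act_le_iff int_pow_closed int_pow_neg inv_closed)
    with \<open>\<sigma> \<in> \<D>\<close> show ?thesis
      by (intro exI [of _ "(j, \<sigma>)"]) (simp add: \<tau>_def)
  qed
  \<comment> \<open>The strict descent comes from alternating \<open>exists_smaller\<close> with
    \<open>below\<close>.\<close>
  have "\<exists>p. \<forall>n. (snd (p n) \<in> \<D> \<and> \<tau> (p n) \<le> \<beta>\<^sub>0) \<and> \<tau> (p (Suc n)) < \<tau> (p n)"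
  proof (rule dependent_nat_choice)
    show "\<exists>p. snd p \<in> \<D> \<and> \<tau> p \<le> \<beta>\<^sub>0"
      using below [OF \<open>\<beta>\<^sub>0 \<noteq> bot\<close>] by simp
  next
    fix p and n :: nat
    assume p: "snd p \<in> \<D> \<and> \<tau> p \<le> \<beta>\<^sub>0"
    then have "\<tau> p \<noteq> bot"
      using g by (auto simp: \<tau>_def \<D>_def split: prod.splits)
    then obtain \<beta> where \<beta>: "\<beta> \<noteq> bot" "\<beta> < \<tau> p"
      by (rule exists_smaller)
    then have "\<beta> \<le> \<beta>\<^sub>0"
      using p by auto
    with below [OF \<beta>(1)] obtain q where "snd q \<in> \<D>" "\<tau> q \<le> \<beta>"
      by blast
    then show "\<exists>q. (snd q \<in> \<D> \<and> \<tau> q \<le> \<beta>\<^sub>0) \<and> \<tau> q < \<tau> p"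
      using \<beta> \<open>\<beta> \<le> \<beta>\<^sub>0\<close> by (meson le_less_trans order_trans)
  qed
  then obtain p where p: "\<And>n. snd (p n) \<in> \<D>" "\<And>n. \<tau> (p (Suc n)) < \<tau> (p n)"
    by blast
  have desc: "\<tau> (p b) < \<tau> (p a)" if "a < b" for a b :: nat
    using that by (induction rule: less_Suc_induct) (use p(2) in \<open>auto intro: less_trans\<close>)
  have "\<not> inj (snd \<circ> p)"
  proof
    assume "inj (snd \<circ> p)"
    moreover have "range (snd \<circ> p) \<subseteq> \<D>"
      using p(1) by auto
    ultimately have "finite (UNIV :: nat set)"
      using \<open>finite \<D>\<close> by (meson finite_imageD finite_subset)
    then show False by simp
  qed
  then obtain a b where "snd (p a) = snd (p b)" "a \<noteq> b"
    by (auto simp: inj_def)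
  then obtain a b where ab: "snd (p a) = snd (p b)" "a < b"
    by (metis linorder_neqE_nat)
  obtain i j \<sigma> where ij: "p a = (i, \<sigma>)" "p b = (j, \<sigma>)"
    using ab(1) by (metis prod.collapse)
  \<comment> \<open>One \<open>\<sigma>\<close> occurs twice in the descending sequence; cancelling
    the shift by \<open>i\<close> shows that the power of \<open>g\<close> with exponent
    \<open>i - j\<close> compresses it.\<close>
  have "\<phi> (g [^] (- int j)) \<sigma> < \<phi> (g [^] (- int i)) \<sigma>"
    using desc [OF ab(2)] by (simp add: ij \<tau>_def)
  then have "\<phi> (g [^] int i) (\<phi> (g [^] (- int j)) \<sigma>) < \<phi> (g [^] int i) (\<phi> (g [^] (- int i)) \<sigma>)"
    using g by simp
  then have "\<phi> (g [^] (int i - int j)) \<sigma> < \<sigma>"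
    using g by (simp flip: act_mult int_pow_mult)
  then show ?thesis
    using compressing_imp_con_not_closed g by blast
qed

text \<open>If all contraction groups were closed, escape would be impossible for \<open>g\<close>
  and \<open>inv g\<close>. The bounded orbits so obtained yield a commutator that contradicts
  \<open>bounded_con_not_closed\<close>.\<close>

theorem exists_con_not_closed:
  assumes g: "g \<in> carrier G" and x: "x \<in> con G T g" "x \<noteq> \<one>"
  shows "\<exists>h\<in>carrier G. \<not> closedin T (con G T h)"
proof (rule ccontr)
  assume closed: "\<not> ?thesis"
  obtain U where U: "subgroup U G" "openin T U" "compactin T U"
    by (rule exists_compact_open_subgroup)
  \<comment> \<open>Both directions are required so that one \<open>V\<close> serves
    \<open>g\<close> and \<open>inv g\<close>.\<close>
  define S where "S = {x \<in> carrier G. conj_pow g 1 x \<in> U} \<inter> {x \<in> carrier G. conj_pow g (- 1) x \<in> U}"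
  have "openin T S" "\<one> \<in> S"
    using subgroup.one_closed [OF U(1)] openin_conj_pow_preimage [OF g U(2)] by (auto simp: S_def g openin_Int)
  then obtain F where F: "finite F" "{y \<in> U. \<forall>\<xi>\<in>F. \<phi> y \<xi> = \<xi>} \<subseteq> S"
    by (rule fixator_within [OF U(3)])
  define V where "V = {v \<in> U. \<forall>\<xi>\<in>F. \<phi> v \<xi> = \<xi>}"
  have VU: "V \<subseteq> U" and VS: "V \<subseteq> S"
    using F(2) by (auto simp: V_def)
  have UG: "U \<subseteq> carrier G"
    by (simp add: U(1) subgroup.subset)
  have "V = U \<inter> {y \<in> carrier G. \<forall>\<xi>\<in>F. \<phi> y \<xi> = \<xi>}"
    using UG by (auto simp: V_def)
  then have openV: "openin T V" "\<one> \<in> V"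
    using U(2) openin_fixator [OF F(1)] subgroup.one_closed [OF U(1)] by (auto intro: openin_Int)
  have forward: "\<exists>\<beta>. \<beta> \<noteq> bot \<and> \<beta> \<le> \<beta>\<^sub>0 \<and> (\<forall>z\<in>rist \<beta> \<inter> V. \<forall>n::nat. conj_pow h (int n) z \<in> V)"
    if h: "h = g \<or> h = inv g" and "\<beta>\<^sub>0 \<noteq> bot" for h \<beta>\<^sub>0
  proof (rule ccontr)
    assume "\<not> ?thesis"
    then have esc: "\<And>\<beta>. \<beta> \<noteq> bot \<Longrightarrow> \<beta> \<le> \<beta>\<^sub>0 \<Longrightarrow> \<exists>z\<in>rist \<beta> \<inter> V. \<exists>n::nat. conj_pow h (int n) z \<notin> V"
      by blast
    have "conj_pow h 1 v \<in> U" if "v \<in> V" for v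
      using that h VS g by (auto simp: S_def conj_pow_inv_base)
    with escaping_imp_con_not_closed [OF U(3) _ F(1) V_def _ \<open>\<beta>\<^sub>0 \<noteq> bot\<close> esc] closed g h
    show False by auto
  qed
  have xG: "x \<in> carrier G"
    using x con_carrier by blast
  obtain \<alpha> where \<alpha>: "\<alpha> \<noteq> bot" "inf \<alpha> (\<phi> x \<alpha>) = bot"
    using exists_displaced [OF xG x(2)] by metis
  \<comment> \<open>Forward orbits are controlled first, then backward orbits on a smaller element;
    by \<open>rist_mono\<close> both controls hold there.\<close>
  obtain \<alpha>\<^sub>1 where \<alpha>1: "\<alpha>\<^sub>1 \<noteq> bot" "\<alpha>\<^sub>1 \<le> \<alpha>"
    "\<And>z n. z \<in> rist \<alpha>\<^sub>1 \<inter> V \<Longrightarrow> conj_pow g (int n) z \<in> V"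
    using forward [of g \<alpha>] \<alpha>(1) by metis
  obtain \<alpha>\<^sub>2 where \<alpha>2: "\<alpha>\<^sub>2 \<noteq> bot" "\<alpha>\<^sub>2 \<le> \<alpha>\<^sub>1"
    "\<And>z n. z \<in> rist \<alpha>\<^sub>2 \<inter> V \<Longrightarrow> conj_pow (inv g) (int n) z \<in> V"
    using forward [of "inv g" \<alpha>\<^sub>1] \<alpha>1(1) by metis
  have bounded: "conj_pow g n v \<in> U" if v: "v \<in> rist \<alpha>\<^sub>2" "v \<in> V" for n v
  proof (cases "n \<ge> 0")
    case True
    then show ?thesis
      using \<alpha>1(3) [of v "nat n"] v rist_mono [OF \<alpha>2(2)] VU by auto
  next
    case False
    then show ?thesis
      using \<alpha>2(3) [of v "nat (- n)"] v VU by (auto simp: conj_pow_inv_base g)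
  qed
  obtain z where z: "z \<in> rist \<alpha>\<^sub>2" "z \<in> V" "z \<noteq> \<one>"
    using rist_nontrivial [OF openV \<alpha>2(1)] by blast
  have zG: "z \<in> carrier G"
    using z(1) rist_carrier by blast
  \<comment> \<open>Since \<open>z\<close> displaces \<open>\<alpha>\<^sub>3\<close>, a nontrivial
    \<open>w\<close> supported there cannot commute with \<open>z\<close>.\<close>
  obtain \<alpha>\<^sub>3 where \<alpha>3: "\<alpha>\<^sub>3 \<noteq> bot" "inf \<alpha>\<^sub>3 (\<phi> z \<alpha>\<^sub>3) = bot" "\<alpha>\<^sub>3 \<le> \<alpha>\<^sub>2"
    using exists_displaced [OF zG z(3)] z(1) by metis
  obtain w where w: "w \<in> rist \<alpha>\<^sub>3" "w \<in> V" "w \<noteq> \<one>"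
    using rist_nontrivial [OF openV \<alpha>3(1)] by blast
  have wG: "w \<in> carrier G"
    using w(1) rist_carrier by blast
  have w2: "w \<in> rist \<alpha>\<^sub>2"
    using w(1) rist_mono [OF \<alpha>3(3)] by blast
  define y where "y = z \<otimes> w \<otimes> inv z \<otimes> inv w"
  have "y \<noteq> \<one>"
  proof
    assume "y = \<one>"
    then have "z \<otimes> w \<otimes> inv z = w"
      using zG wG by (metis inv_closed inv_equality inv_inv m_closed y_def)
    then have "w \<in> rist (\<phi> z \<alpha>\<^sub>3)"
      using rist_conj [OF zG w(1)] by simp
    then show False
      using rist_disjoint_Int [OF w(1) _ \<alpha>3(2)] w(3) by blast
  qed
  have "conj_pow g n y \<in> U" for n
    using bounded [OF z(1,2), of n] bounded [OF w2 w(2), of n]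
    by (simp add: y_def conj_pow_mult conj_pow_inv g zG wG subgroup.m_closed [OF U(1)] subgroup.m_inv_closed [OF U(1)])
  moreover have "y \<in> con G T g"
  proof -
    define z' where "z' = x \<otimes> z \<otimes> inv x"
    have z'G: "z' \<in> carrier G"
      by (simp add: z'_def xG zG)
    have "z' \<in> rist (\<phi> x \<alpha>)"
      using rist_conj [OF xG] z(1) rist_mono \<alpha>1(2) \<alpha>2(2) unfolding z'_def by blast
    moreover have "w \<in> rist \<alpha>"
      using w2 rist_mono \<alpha>1(2) \<alpha>2(2) by blast
    ultimately have comm: "w \<otimes> z' = z' \<otimes> w"
      using rist_disjoint_commute \<alpha>(2) by metis
    \<comment> \<open>\<open>c\<close> is the commutator of \<open>z\<close> and \<open>x\<close>,
      in the contraction group because \<open>z\<close> has a bounded orbit. So is its commutator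
      with \<open>w\<close>, which collapses to \<open>y\<close> since \<open>z'\<close> commutes
      with \<open>w\<close>.\<close>
    define c where "c = z \<otimes> inv z'"
    have c_eq: "c = (z \<otimes> x \<otimes> inv z) \<otimes> inv x"
      using xG zG by (simp add: c_def z'_def inv_mult_group m_assoc)
    have "c \<in> con G T g"
      unfolding c_eq using con_mult [OF U g] con_conj [OF U g x(1) zG] con_inv [OF U g x(1)]
        bounded [OF z(1,2)] by blast
    then have "c \<otimes> (w \<otimes> inv c \<otimes> inv w) \<in> con G T g"
      using con_mult [OF U g] con_conj [OF U g _ wG] con_inv [OF U g] bounded [OF w2 w(2)] by blast
    moreover have "c \<otimes> (w \<otimes> inv c \<otimes> inv w) = z \<otimes> (inv z' \<otimes> (w \<otimes> z')) \<otimes> inv z \<otimes> inv w"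
      using zG wG z'G by (simp add: c_def inv_mult_group m_assoc)
    moreover have "inv z' \<otimes> (w \<otimes> z') = w"
      using z'G wG by (simp add: comm) (simp flip: m_assoc)
    ultimately show ?thesis
      by (simp add: y_def)
  qed
  ultimately show False
    using bounded_con_not_closed [OF U g] \<open>y \<noteq> \<one>\<close> closed g by blast
qed

end

theorem corollary1p21:
  fixes G :: "('a, 'm) monoid_scheme"
    and T :: "'a topology"
    and \<phi> :: "'a \<Rightarrow> 'b::boolean_algebra \<Rightarrow> 'b"
  assumes "tdlc_group G T"
    and "carrier G \<noteq> {\<one>\<^bsub>G\<^esub>}"
    and "faithful_weakly_decomposable_action G T \<phi>"
    and "\<exists>g \<in> carrier G. con G T g \<noteq> {\<one>\<^bsub>G\<^esub>}"
  shows "\<exists>h \<in> carrier G. \<not> closedin T (con G T h)"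
proof -
  interpret tdlc_weakly_decomposable G T \<phi>
    using assms(1,3) by (rule tdlc_weakly_decomposable.intro)
  obtain g where g: "g \<in> carrier G" "con G T g \<noteq> {\<one>\<^bsub>G\<^esub>}"
    using assms(4) by blast
  have "\<one>\<^bsub>G\<^esub> \<in> con G T g"
    using g(1) by (simp add: con_altdef limitin_const_iff topspace_eq_carrier)
  with g obtain x where "x \<in> con G T g" "x \<noteq> \<one>\<^bsub>G\<^esub>"
    by blast
  then show ?thesis
    by (rule exists_con_not_closed [OF g(1)])
qed

end
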